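(* The translation $[\![\cdot]\!]_{\lambda}$ of SF-terms into $\lambda$-terms preserves reduction and strong normalisation: for all SF-terms $M, N$, if $M \rightarrow_{\mathrm{SF}}^{\ast} N$ then $[\![M]\!]_{\lambda} \rightarrow_{\beta}^{\ast} [\![N]\!]_{\lambda}$; and if $M$ is strongly normalising with respect to $\rightarrow_{\mathrm{SF}}$ then $[\![M]\!]_{\lambda}$ is strongly normalising with respect to $\beta$-reduction.
   Context: SF-calculus: terms are given by $M, N ::= \mathbf{S} \mid \mathbf{F} \mid M\,N$ (application, left-associative; no variables). Terms of the form $\mathbf{S}$, $\mathbf{F}$, $\mathbf{S}\,M$, $\mathbf{F}\,M$, $\mathbf{S}\,M\,N$, $\mathbf{F}\,M\,N$ are called factorable forms. The one-step reduction $\rightarrow_{\mathrm{SF}}$ is the smallest relation closed under term contexts satisfying: $\mathbf{S}\,M\,N\,X \rightarrow_{\mathrm{SF}} M\,X\,(N\,X)$; $\mathbf{F}\,O\,M\,N \rightarrow_{\mathrm{SF}} M$ if $O$ is $\mathbf{S}$ or $\mathbf{F}$; $\mathbf{F}\,(P\,Q)\,M\,N \rightarrow_{\mathrm{SF}} N\,P\,Q$ if $P\,Q$ is a factorable form; $\rightarrow_{\mathrm{SF}}^{\ast}$ is its reflexive transitive closure. Curryfied applicative SF-calculus: the set $\mathcal{E}$ of first-order rewrite rules over the signature with constructors $\mathbf{S}_0,\mathbf{F}_0$ (arity 0), $\mathbf{S}_1,\mathbf{F}_1$ (arity 1), $\mathbf{S}_2,\mathbf{F}_2$ (arity 2), and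 program symbols $\mathsf{app}$ (arity 2) and $\mathsf{fred}$ (arity 3): $\mathsf{app}(\mathbf{S}_0,x)\to\mathbf{S}_1(x)$; $\mathsf{app}(\mathbf{S}_1(x),y)\to\mathbf{S}_2(x,y)$; $\mathsf{app}(\mathbf{S}_2(x,y),z)\to\mathsf{app}(\mathsf{app}(x,z),\mathsf{app}(y,z))$; $\mathsf{app}(\mathbf{F}_0,x)\to\mathbf{F}_1(x)$; $\mathsf{app}(\mathbf{F}_1(x),y)\to\mathbf{F}_2(x,y)$; $\mathsf{app}(\mathbf{F}_2(x,y),z)\to\mathsf{fred}(x,y,z)$; $\mathsf{fred}(\mathbf{S}_0,y,z)\to y$; $\mathsf{fred}(\mathbf{F}_0,y,z)\to y$; $\mathsf{fred}(\mathbf{S}_1(x),y,z)\to\mathsf{app}(\mathsf{app}(z,\mathbf{S}_0),x)$; $\mathsf{fred}(\mathbf{F}_1(x),y,z)\to\mathsf{app}(\mathsf{app}(z,\mathbf{F}_0),x)$; $\mathsf{fred}(\mathbf{S}_2(p,q),y,z)\to\mathsf{app}(\mathsf{app}(z,\mathsf{app}(\mathbf{S}_0,p)),q)$; $\mathsf{fred}(\mathbf{F}_2(p,q),y,z)\to\mathsf{app}(\mathsf{app}(z,\mathsf{app}(\mathbf{F}_0,p)),q)$. Every rule has the form $f(c(x_1,\dots,x_m),y_1,\dots,y_n)\to b$ with $f$ a program symbol and $c$ a constructor, and there is exactly one rule for each pair $(f,c)$. Translation to rewrite terms: $[\![\mathbf{S}]\!]_{@}=\mathbf{S}_0$, $[\![\mathbf{F}]\!]_{@}=\mathbf{F}_0$,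 $[\![M\,N]\!]_{@}=\mathsf{app}([\![M]\!]_{@},[\![N]\!]_{@})$. Canonical representation (Berarducci–Böhm). Write $\langle t_1,\dots,t_n\rangle$ for $\lambda x.\,x\,t_1\cdots t_n$ and $\Pi^n_k = \lambda x_1\ldots x_n.\,x_k$. Enumerate the constructors as $c_1,\dots,c_r$ ($r=6$) and the programs as $f_1,\dots,f_k$ ($k=2$), in some fixed order. For a map $\phi$ from symbols to $\lambda$-terms, extend it to (extended) terms by $x^{\phi}=x$, $(\lambda x.M)^{\phi}=\lambda x.M^{\phi}$, $(MN)^{\phi}=M^{\phi}N^{\phi}$, $g(t_1,\dots,t_n)^{\phi}=\phi(g)\,t_1^{\phi}\cdots t_n^{\phi}$. Define $\vartheta(c_j)=\lambda x_1\ldots x_n f.\,f\,\Pi^r_j\,x_1\ldots x_n\,f$ where $n$ is the arity of $c_j$. Choose fresh distinct variables $v_1,\dots,v_k$ and set $\psi(f_i)=\langle v_i,\dots,v_k,v_1,\dots,v_{i-1}\rangle$. For the rule $f_i(c_j(x_1,\dots,x_m),y_1,\dots,y_n)\to b_{(i,j)}$ put $t_{(i,j)}=\lambda x_1\ldots x_m\,v_i\ldots v_k v_1\ldots v_{i-1}\,y_1\ldots y_n.\,((b_{(i,j)})^{\psi})^{\vartheta}$, $t_i=\langle t_{(i,1)},\dots,t_{(i,r)}\rangle$, and $\zeta(f_i)=\langle t_i,\dots,t_k,t_1,\dots,t_{i-1}\rangle$. Let $\phi_{\mathrm{SF}}=\vartheta\cup\zeta$. Finally $[\![M]\!]_{\lambda}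 = ([\![M]\!]_{@})^{\phi_{\mathrm{SF}}}$. $\rightarrow_{\beta}^{\ast}$ denotes multi-step $\beta$-reduction; a term is strongly normalising if it admits no infinite reduction sequence. *)

theory Defs
  imports "HOL-Library.Countable"
begin

definition strongly_normalising :: "('a \<Rightarrow> 'a \<Rightarrow> bool) \<Rightarrow> 'a \<Rightarrow> bool" where
  "strongly_normalising R a \<longleftrightarrow> \<not> (\<exists>s :: nat \<Rightarrow> 'a. s 0 = a \<and> (\<forall>i. R (s i) (s (Suc i))))"


section \<open>SF-calculus\<close>

datatype sf = S | F | SF_App sf sf (infixl "\<cdot>" 75)

inductive factorable :: "sf \<Rightarrow> bool" where
  "factorable S"
| "factorable F"
| "factorable (S \<cdot> M)"
| "factorable (F \<cdot> M)"
| "factorable (S \<cdot> M \<cdot> N)"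
| "factorable (F \<cdot> M \<cdot> N)"

inductive sf_red :: "sf \<Rightarrow> sf \<Rightarrow> bool" (infix "\<rightarrow>SF" 50) where
  sf_S: "S \<cdot> M \<cdot> N \<cdot> X \<rightarrow>SF M \<cdot> X \<cdot> (N \<cdot> X)"
| sf_F_atom: "Q = S \<or> Q = F \<Longrightarrow> F \<cdot> Q \<cdot> M \<cdot> N \<rightarrow>SF M"
| sf_F_compound: "factorable (P \<cdot> Q) \<Longrightarrow> F \<cdot> (P \<cdot> Q) \<cdot> M \<cdot> N \<rightarrow>SF N \<cdot> P \<cdot> Q"
| sf_appL: "M \<rightarrow>SF M' \<Longrightarrow> M \<cdot> N \<rightarrow>SF M' \<cdot> N"
| sf_appR: "N \<rightarrow>SF N' \<Longrightarrow> M \<cdot> N \<rightarrow>SF M \<cdot> N'"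


section \<open>Lambda-terms modulo alpha (de Bruijn) and beta-reduction\<close>

datatype lam = Var nat | App lam lam | Lam lam

primrec lam_lift :: "nat \<Rightarrow> lam \<Rightarrow> lam" where
  "lam_lift k (Var i) = Var (if i < k then i else Suc i)"
| "lam_lift k (App s t) = App (lam_lift k s) (lam_lift k t)"
| "lam_lift k (Lam s) = Lam (lam_lift (Suc k) s)"

text \<open>\<open>lam_subst k u s\<close> replaces index \<open>k\<close> by \<open>u\<close> in \<open>s\<close> and lowers the indices above \<open>k\<close>,
  since the binder of \<open>k\<close> disappears.\<close>

primrec lam_subst :: "nat \<Rightarrow> lam \<Rightarrow> lam \<Rightarrow> lam" where
  "lam_subst k u (Var i) = (if i < k then Var i else if i = k then u else Var (i - 1))"
| "lam_subst k u (App s t) = App (lam_subst k u s) (lam_subst k u t)"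
| "lam_subst k u (Lam s) = Lam (lam_subst (Suc k) (lam_lift 0 u) s)"

inductive beta :: "lam \<Rightarrow> lam \<Rightarrow> bool" (infix "\<rightarrow>\<beta>" 50) where
  beta_redex: "App (Lam s) t \<rightarrow>\<beta> lam_subst 0 t s"
| beta_appL: "s \<rightarrow>\<beta> s' \<Longrightarrow> App s t \<rightarrow>\<beta> App s' t"
| beta_appR: "t \<rightarrow>\<beta> t' \<Longrightarrow> App s t \<rightarrow>\<beta> App s t'"
| beta_Lam: "s \<rightarrow>\<beta> s' \<Longrightarrow> Lam s \<rightarrow>\<beta> Lam s'"


section \<open>Extended terms over the signature of curryfied SF-calculus\<close>

datatype constr = S0 | S1 | S2 | F0 | F1 | F2
datatype prog = app | fred
datatype symbol = Con constr | Prog prog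

fun constr_arity :: "constr \<Rightarrow> nat" where
  "constr_arity S0 = 0"
| "constr_arity F0 = 0"
| "constr_arity S1 = 1"
| "constr_arity F1 = 1"
| "constr_arity S2 = 2"
| "constr_arity F2 = 2"

fun prog_arity :: "prog \<Rightarrow> nat" where
  "prog_arity app = 2"
| "prog_arity fred = 3"

text \<open>The sorts of names needed by the construction: \<open>x\<^sub>i\<close>, \<open>y\<^sub>i\<close>, the fresh variable \<open>v\<^sub>f\<close> chosen
  for the program \<open>f\<close>, the bound variable \<open>f\<close> in the representation of constructors, and the bound
  variable of a tuple.\<close>

datatype name = X nat | Y nat | V prog | Fvar | Tvar

instance prog :: countable by countable_datatype
instance name :: countable by countable_datatype

datatype xterm = XVar name | XApp xterm xterm | XLam name xterm | Fun symbol "xterm list"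

definition XApps :: "xterm \<Rightarrow> xterm list \<Rightarrow> xterm" where
  "XApps t ts = foldl XApp t ts"

definition XLams :: "name list \<Rightarrow> xterm \<Rightarrow> xterm" where
  "XLams xs t = foldr XLam xs t"

text \<open>\<open>extend \<phi> t\<close> is \<open>t\<^sup>\<phi>\<close>; symbols outside the domain of \<open>\<phi>\<close> are kept. Substitution under
  \<open>XLam\<close> is not capture avoiding, but it only ever inserts closed terms there.\<close>

fun extend :: "(symbol \<rightharpoonup> xterm) \<Rightarrow> xterm \<Rightarrow> xterm" where
  "extend \<phi> (XVar x) = XVar x"
| "extend \<phi> (XLam x t) = XLam x (extend \<phi> t)"
| "extend \<phi> (XApp s t) = XApp (extend \<phi> s) (extend \<phi> t)"
| "extend \<phi> (Fun g ts) =
     (case \<phi> g of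
        Some u \<Rightarrow> XApps u (map (extend \<phi>) ts)
      | None \<Rightarrow> Fun g (map (extend \<phi>) ts))"

text \<open>The lambda-term (alpha-equivalence class) denoted by a symbol-free extended term. The
  environment gives the index of every name; \<open>to_nat\<close> keeps free names distinct.\<close>

fun nameless :: "(name \<Rightarrow> nat) \<Rightarrow> xterm \<Rightarrow> lam" where
  "nameless \<rho> (XVar x) = Var (\<rho> x)"
| "nameless \<rho> (XApp s t) = App (nameless \<rho> s) (nameless \<rho> t)"
| "nameless \<rho> (XLam x t) = Lam (nameless (\<lambda>y. if y = x then 0 else Suc (\<rho> y)) t)"
| "nameless \<rho> (Fun g ts) = undefined"

definition to_lam :: "xterm \<Rightarrow> lam" where
  "to_lam t = nameless to_nat t"


section \<open>The rewrite rules of curryfied SF-calculus\<close>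

abbreviation con :: "constr \<Rightarrow> xterm list \<Rightarrow> xterm" where
  "con c ts \<equiv> Fun (Con c) ts"

abbreviation app' :: "xterm \<Rightarrow> xterm \<Rightarrow> xterm" where
  "app' s t \<equiv> Fun (Prog app) [s, t]"

abbreviation fred' :: "xterm \<Rightarrow> xterm \<Rightarrow> xterm \<Rightarrow> xterm" where
  "fred' s t u \<equiv> Fun (Prog fred) [s, t, u]"

abbreviation x\<^sub>1 :: xterm where "x\<^sub>1 \<equiv> XVar (X 1)"
abbreviation x\<^sub>2 :: xterm where "x\<^sub>2 \<equiv> XVar (X 2)"
abbreviation y\<^sub>1 :: xterm where "y\<^sub>1 \<equiv> XVar (Y 1)"
abbreviation y\<^sub>2 :: xterm where "y\<^sub>2 \<equiv> XVar (Y 2)"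

text \<open>\<open>rule_rhs f c\<close> is the right-hand side \<open>b\<close> of the unique rule
  \<open>f(c(x\<^sub>1,\<dots>,x\<^sub>m), y\<^sub>1,\<dots>,y\<^sub>n) \<rightarrow> b\<close> for the pair \<open>(f, c)\<close>, with the variables of the rule named
  by their position in the left-hand side.\<close>

fun rule_rhs :: "prog \<Rightarrow> constr \<Rightarrow> xterm" where
  "rule_rhs app S0 = con S1 [y\<^sub>1]"
| "rule_rhs app S1 = con S2 [x\<^sub>1, y\<^sub>1]"
| "rule_rhs app S2 = app' (app' x\<^sub>1 y\<^sub>1) (app' x\<^sub>2 y\<^sub>1)"
| "rule_rhs app F0 = con F1 [y\<^sub>1]"
| "rule_rhs app F1 = con F2 [x\<^sub>1, y\<^sub>1]"
| "rule_rhs app F2 = fred' x\<^sub>1 x\<^sub>2 y\<^sub>1"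
| "rule_rhs fred S0 = y\<^sub>1"
| "rule_rhs fred F0 = y\<^sub>1"
| "rule_rhs fred S1 = app' (app' y\<^sub>2 (con S0 [])) x\<^sub>1"
| "rule_rhs fred F1 = app' (app' y\<^sub>2 (con F0 [])) x\<^sub>1"
| "rule_rhs fred S2 = app' (app' y\<^sub>2 (app' (con S0 []) x\<^sub>1)) x\<^sub>2"
| "rule_rhs fred F2 = app' (app' y\<^sub>2 (app' (con F0 []) x\<^sub>1)) x\<^sub>2"

fun to_app :: "sf \<Rightarrow> xterm" where
  "to_app S = con S0 []"
| "to_app F = con F0 []"
| "to_app (M \<cdot> N) = app' (to_app M) (to_app N)"


section \<open>The canonical representation\<close>

text \<open>The enumerations of the constructors and of the programs are parameters \<open>cs\<close> and \<open>fs\<close>.\<close>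

definition enumeration :: "'a list \<Rightarrow> bool" where
  "enumeration as \<longleftrightarrow> distinct as \<and> set as = UNIV"

definition position :: "'a list \<Rightarrow> 'a \<Rightarrow> nat" where
  "position as a = Suc (length (takeWhile (\<lambda>b. b \<noteq> a) as))"

text \<open>\<open>a\<^sub>i, \<dots>, a\<^sub>k, a\<^sub>1, \<dots>, a\<^sub>i\<^sub>-\<^sub>1\<close> for the element \<open>a = a\<^sub>i\<close> of the enumeration \<open>a\<^sub>1, \<dots>, a\<^sub>k\<close>.\<close>

definition cycle_from :: "'a list \<Rightarrow> 'a \<Rightarrow> 'a list" where
  "cycle_from as a = dropWhile (\<lambda>b. b \<noteq> a) as @ takeWhile (\<lambda>b. b \<noteq> a) as"

definition xvec :: "nat \<Rightarrow> name list" where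
  "xvec n = map X [1..<Suc n]"

definition yvec :: "nat \<Rightarrow> name list" where
  "yvec n = map Y [1..<Suc n]"

text \<open>\<open>\<langle>t\<^sub>1, \<dots>, t\<^sub>n\<rangle>\<close>; the name \<open>Tvar\<close> does not occur free in any of the components used below.\<close>

definition tuple :: "xterm list \<Rightarrow> xterm" where
  "tuple ts = XLam Tvar (XApps (XVar Tvar) ts)"

definition Pi_sel :: "nat \<Rightarrow> nat \<Rightarrow> xterm" where
  "Pi_sel n k = XLams (xvec n) (XVar (X k))"

definition theta_constr :: "constr list \<Rightarrow> constr \<Rightarrow> xterm" where
  "theta_constr cs c =
     (let xs = xvec (constr_arity c) in
      XLams (xs @ [Fvar])
        (XApps (XVar Fvar) (Pi_sel (length cs) (position cs c) # map XVar xs @ [XVar Fvar])))"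

fun theta :: "constr list \<Rightarrow> symbol \<rightharpoonup> xterm" where
  "theta cs (Con c) = Some (theta_constr cs c)"
| "theta cs (Prog f) = None"

fun psi :: "prog list \<Rightarrow> symbol \<rightharpoonup> xterm" where
  "psi fs (Con c) = None"
| "psi fs (Prog f) = Some (tuple (map (\<lambda>g. XVar (V g)) (cycle_from fs f)))"

definition t_rule :: "constr list \<Rightarrow> prog list \<Rightarrow> prog \<Rightarrow> constr \<Rightarrow> xterm" where
  "t_rule cs fs f c =
     XLams (xvec (constr_arity c) @ map V (cycle_from fs f) @ yvec (prog_arity f - 1))
       (extend (theta cs) (extend (psi fs) (rule_rhs f c)))"

definition t_prog :: "constr list \<Rightarrow> prog list \<Rightarrow> prog \<Rightarrow> xterm" where
  "t_prog cs fs f = tuple (map (t_rule cs fs f) cs)"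

fun zeta :: "constr list \<Rightarrow> prog list \<Rightarrow> symbol \<rightharpoonup> xterm" where
  "zeta cs fs (Con c) = None"
| "zeta cs fs (Prog f) = Some (tuple (map (t_prog cs fs) (cycle_from fs f)))"

definition phi_SF :: "constr list \<Rightarrow> prog list \<Rightarrow> symbol \<rightharpoonup> xterm" where
  "phi_SF cs fs = theta cs ++ zeta cs fs"

definition to_lambda :: "constr list \<Rightarrow> prog list \<Rightarrow> sf \<Rightarrow> lam" where
  "to_lambda cs fs M = to_lam (extend (phi_SF cs fs) (to_app M))"

end

(* A head reduction takes the representation of f(c(x), y) to that of the right-hand side of its
   rule, which gives the simulation. For strong normalisation, a head redex is strongly normalising
   as soon as its argument and its contractum are. Evaluate a ground rewrite term on a stack machine:
   f(t, u) pushes the frame f([], u) and continues with t; a constructor term meeting a frame fires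
   a rule. Head reduction of the representation simulates the machine, and the arguments it
   discards or duplicates represent proper subterms or are fixed normalising terms, so the claim
   follows by induction along SF-reduction and the subterm relation, with a weight for the machine
   steps that leave the SF-term unchanged. *)

theory Submission imports Defs
begin

section \<open>De Bruijn substitution and its compatibility with beta-reduction\<close>

section \<open>Substitution and strong normalisation\<close>

lemma lift_lift: "i < Suc k \<Longrightarrow> lam_lift (Suc k) (lam_lift i t) = lam_lift i (lam_lift k t)"
  by (induction t arbitrary: i k) auto

lemma lift_subst:
  "j < Suc i \<Longrightarrow> lam_lift i (lam_subst j s t) = lam_subst j (lam_lift i s) (lam_lift (Suc i) t)"
  by (induction t arbitrary: i j s) (auto simp: lift_lift)

lemma lift_subst_lt:
  "i < Suc j \<Longrightarrow> lam_lift i (lam_subst j s t) = lam_subst (Suc j) (lam_lift i s) (lam_lift i t)"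
  by (induction t arbitrary: i j s) (auto simp: lift_lift)

lemma subst_lift [simp]: "lam_subst k s (lam_lift k t) = t"
  by (induction t arbitrary: k s) auto

lemma subst_subst:
  "i < Suc j \<Longrightarrow>
   lam_subst i (lam_subst j v u) (lam_subst (Suc j) (lam_lift i v) t) = lam_subst j v (lam_subst i u t)"
  by (induction t arbitrary: i j u v) (auto simp: lift_lift [symmetric] lift_subst_lt)

lemma beta_subst: "s \<rightarrow>\<beta> s' \<Longrightarrow> lam_subst k u s \<rightarrow>\<beta> lam_subst k u s'"
proof (induction arbitrary: k u rule: beta.induct)
  case (beta_redex s t)
  show ?case
    using beta.beta_redex[of "lam_subst (Suc k) (lam_lift 0 u) s" "lam_subst k u t"]
    by (simp add: subst_subst)
qed (auto intro: beta.intros)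

lemma beta_lift: "s \<rightarrow>\<beta> s' \<Longrightarrow> lam_lift k s \<rightarrow>\<beta> lam_lift k s'"
proof (induction arbitrary: k rule: beta.induct)
  case (beta_redex s t)
  show ?case
    using beta.beta_redex[of "lam_lift (Suc k) s" "lam_lift k t"] by (simp add: lift_subst)
qed (auto intro: beta.intros)

lemma betas_App:
  assumes "beta\<^sup>*\<^sup>* s s'" and "beta\<^sup>*\<^sup>* t t'"
  shows "beta\<^sup>*\<^sup>* (App s t) (App s' t')"
proof -
  have "beta\<^sup>*\<^sup>* (App s t) (App s' t)"
    using assms(1) by induction (auto intro: rtranclp.rtrancl_into_rtrancl beta.intros)
  moreover have "beta\<^sup>*\<^sup>* (App s' t) (App s' t')"
    using assms(2) by induction (auto intro: rtranclp.rtrancl_into_rtrancl beta.intros)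
  ultimately show ?thesis by simp
qed

lemma betas_Lam: "beta\<^sup>*\<^sup>* s s' \<Longrightarrow> beta\<^sup>*\<^sup>* (Lam s) (Lam s')"
  by (induction rule: rtranclp.induct) (auto intro: rtranclp.rtrancl_into_rtrancl beta.intros)

text \<open>\<open>u\<close> may occur in \<open>s\<close> any number of times or not at all, so one
  step becomes many or none.\<close>

lemma betas_subst_arg: "u \<rightarrow>\<beta> u' \<Longrightarrow> beta\<^sup>*\<^sup>* (lam_subst k u s) (lam_subst k u' s)"
  by (induction s arbitrary: k u u') (auto intro!: betas_App betas_Lam intro: beta_lift)

abbreviation Apps :: "lam \<Rightarrow> lam list \<Rightarrow> lam" where
  "Apps s ts \<equiv> foldl App s ts"

lemma beta_Apps: "s \<rightarrow>\<beta> s' \<Longrightarrow> Apps s ts \<rightarrow>\<beta> Apps s' ts"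
  by (induction ts arbitrary: s s') (auto intro: beta.intros)

lemma betas_Apps: "beta\<^sup>*\<^sup>* s s' \<Longrightarrow> beta\<^sup>*\<^sup>* (Apps s ts) (Apps s' ts)"
  by (induction ts arbitrary: s s') (auto intro: betas_App)

section \<open>Strong normalisation: neutral terms and head expansion\<close>

abbreviation sn :: "lam \<Rightarrow> bool" where
  "sn \<equiv> Wellfounded.accp (\<lambda>t s. s \<rightarrow>\<beta> t)"

lemma sn_betas: "sn s \<Longrightarrow> beta\<^sup>*\<^sup>* s t \<Longrightarrow> sn t"
  by (rotate_tac, induction rule: rtranclp_induct) (auto dest: accp_downward)

lemma sn_Lam: "sn s \<Longrightarrow> sn (Lam s)"
proof (induction rule: accp_induct_rule)
  case (1 s)
  show ?case
  proof (rule accpI)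
    fix t assume "Lam s \<rightarrow>\<beta> t"
    then show "sn t" by cases (use 1 in auto)
  qed
qed

text \<open>Neutral terms: they never reduce to an abstraction, so applying one creates no redex at
  the root.\<close>

inductive var_headed :: "lam \<Rightarrow> bool" where
  "var_headed (Var i)"
| "var_headed s \<Longrightarrow> var_headed (App s t)"

inductive_cases var_headed_AppE: "var_headed (App s t)"
inductive_cases var_headed_LamE: "var_headed (Lam s)"

lemma var_headed_beta: "s \<rightarrow>\<beta> s' \<Longrightarrow> var_headed s \<Longrightarrow> var_headed s'"
  by (induction rule: beta.induct) (auto elim!: var_headed_AppE var_headed_LamE intro: var_headed.intros)

lemma sn_var_headed_App:
  assumes "sn s" and "sn t" and "var_headed s"
  shows "sn (App s t)"
  using assms
proof (induction arbitrary: t rule: accp_induct_rule)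
  case outer: (1 s)
  from outer.prems(1) show ?case
  proof (induction rule: accp_induct_rule)
    case (1 t)
    show ?case
    proof (rule accpI)
      fix z assume "App s t \<rightarrow>\<beta> z"
      then show "sn z"
      proof cases
        case (beta_redex s')
        then show ?thesis using outer.prems(2) by (auto elim: var_headed_LamE)
      next
        case (beta_appL s')
        then show ?thesis
          using outer 1(1) by (auto intro: var_headed_beta)
      qed (use 1 in auto)
    qed
  qed
qed

lemma sn_Var: "sn (Var i)"
proof (rule accpI)
  fix z assume "Var i \<rightarrow>\<beta> z"
  then show "sn z" by cases
qed

lemma sn_Var_Apps: "\<forall>t\<in>set ts. sn t \<Longrightarrow> sn (Apps (Var i) ts)"
proof -
  assume "\<forall>t\<in>set ts. sn t"
  then have "sn (Apps (Var i) ts) \<and> var_headed (Apps (Var i) ts)"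
    by (induction ts rule: rev_induct) (auto intro: sn_Var sn_var_headed_App var_headed.intros)
  then show ?thesis ..
qed

text \<open>In the last case the step lies in the arguments and holds for every head
  \<open>h\<close>, so that it can be repeated behind the contractum.\<close>

lemma beta_redex_Apps_cases:
  assumes "Apps (App (Lam s) t) ts \<rightarrow>\<beta> z"
  obtains "z = Apps (lam_subst 0 t s) ts"
  | s' where "s \<rightarrow>\<beta> s'" "z = Apps (App (Lam s') t) ts"
  | t' where "t \<rightarrow>\<beta> t'" "z = Apps (App (Lam s) t') ts"
  | ts' where "\<And>h. Apps h ts \<rightarrow>\<beta> Apps h ts'" "z = Apps (App (Lam s) t) ts'"
  using assms
proof (induction ts arbitrary: z thesis rule: rev_induct)
  case Nil
  from Nil.prems(5) have "App (Lam s) t \<rightarrow>\<beta> z" by simp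
  then show ?case
  proof cases
    case (beta_appL u)
    from beta_appL(2) show ?thesis
      by cases (use beta_appL(1) Nil.prems(2) in auto)
  qed (use Nil.prems in auto)
next
  case (snoc a ts)
  from snoc.prems(5) have "App (Apps (App (Lam s) t) ts) a \<rightarrow>\<beta> z" by simp
  then show ?case
  proof cases
    case (beta_redex u)
    have "Apps (App h k) ts \<noteq> Lam u" for h k by (induction ts rule: rev_induct) auto
    then show ?thesis using beta_redex by metis
  next
    case (beta_appL u)
    from beta_appL(2) show ?thesis
    proof (rule snoc.IH[rotated 4])
      fix ts' assume "\<And>h. Apps h ts \<rightarrow>\<beta> Apps h ts'" "u = Apps (App (Lam s) t) ts'"
      then show ?thesis
        using beta_appL(1) by (intro snoc.prems(4)[of "ts' @ [a]"]) (auto intro: beta.intros)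
    qed (use beta_appL(1) snoc.prems in auto)
  next
    case (beta_appR a')
    then show ?thesis
      by (intro snoc.prems(4)[of "ts @ [a']"]) (auto intro: beta.intros)
  qed
qed

text \<open>Outer induction on \<open>t\<close>, inner induction on the contractum. The contractum
  alone says nothing about \<open>t\<close> when the substitution erases it, hence the assumption on
  \<open>t\<close>.\<close>

lemma sn_head_expansion:
  assumes "sn t" and "sn (Apps (lam_subst 0 t s) ts)"
  shows "sn (Apps (Lam s) (t # ts))"
  using assms
proof (induction arbitrary: s ts rule: accp_induct_rule)
  case outer: (1 t)
  \<comment> \<open>Naming the contractum lets the inner induction follow its reducts while
    \<open>s\<close> and \<open>ts\<close> change.\<close>
  define q where "q = Apps (lam_subst 0 t s) ts"
  have "sn q" using outer.prems q_def by simp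
  then show ?case using q_def
  proof (induction arbitrary: s ts rule: accp_induct_rule)
    case (1 q)
    have "sn z" if "Apps (App (Lam s) t) ts \<rightarrow>\<beta> z" for z
      using that
    proof (cases rule: beta_redex_Apps_cases)
      case 1
      then show ?thesis using "1.hyps" "1.prems" by simp
    next
      case (2 s')
      have "q \<rightarrow>\<beta> Apps (lam_subst 0 t s') ts"
        using 2 "1.prems" by (auto intro: beta_Apps beta_subst)
      then show ?thesis using "1.IH" 2 by simp
    next
      \<comment> \<open>The contractum stays the same if \<open>t\<close> is erased; the descent is
        from \<open>t\<close> to \<open>t'\<close> in the outer induction.\<close>
      case (3 t')
      have "beta\<^sup>*\<^sup>* q (Apps (lam_subst 0 t' s) ts)"
        using 3 "1.prems" by (auto intro: betas_Apps betas_subst_arg)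
      then have "sn (Apps (lam_subst 0 t' s) ts)"
        using "1.hyps" sn_betas by blast
      then show ?thesis using outer.IH[of t' s ts] 3 by simp
    next
      case (4 ts')
      have "q \<rightarrow>\<beta> Apps (lam_subst 0 t s) ts'"
        using 4 "1.prems" by auto
      then show ?thesis using "1.IH" 4 by simp
    qed
    then show ?case by (auto intro: accpI)
  qed
qed

text \<open>Being a reduction for every \<open>A\<close>, and reflecting strong normalisation for \<open>A\<close> the set of strongly
  normalising terms, this lets one computation serve both halves of the theorem.\<close>

inductive head_red :: "lam set \<Rightarrow> lam \<Rightarrow> lam \<Rightarrow> bool" for A where
  refl: "head_red A s s"
| step: "t \<in> A \<Longrightarrow> head_red A (Apps (lam_subst 0 t s) ts) z \<Longrightarrow> head_red A (Apps (App (Lam s) t) ts) z"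

lemma head_red_trans [trans]: "head_red A s t \<Longrightarrow> head_red A t u \<Longrightarrow> head_red A s u"
  by (induction rule: head_red.induct) (auto intro: head_red.intros)

lemma head_red_betas: "head_red A s t \<Longrightarrow> beta\<^sup>*\<^sup>* s t"
proof (induction rule: head_red.induct)
  case (step t s ts z)
  have "Apps (App (Lam s) t) ts \<rightarrow>\<beta> Apps (lam_subst 0 t s) ts"
    by (intro beta_Apps beta.intros)
  with step show ?case by simp
qed simp

lemma head_red_sn: "head_red {s. sn s} s t \<Longrightarrow> sn t \<Longrightarrow> sn s"
  by (induction rule: head_red.induct) (auto dest: sn_head_expansion)


section \<open>Extended terms as lambda-terms: environments, iterated abstractions and
  tuples\<close>

section \<open>Extended terms in an environment\<close>

fun shift :: "(name \<Rightarrow> lam) \<Rightarrow> name \<Rightarrow> name \<Rightarrow> lam" where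
  "shift \<sigma> x y = (if y = x then Var 0 else lam_lift 0 (\<sigma> y))"

text \<open>Unlike \<open>nameless\<close>, which is the case of an environment of variables, this is stable under
  instantiation of the environment, so that \<open>\<beta>\<close>-reduction becomes an update of it. The value on
  symbols is junk, closed in order that no side condition is needed for that.\<close>

fun interp :: "(name \<Rightarrow> lam) \<Rightarrow> xterm \<Rightarrow> lam" where
  "interp \<sigma> (XVar x) = \<sigma> x"
| "interp \<sigma> (XApp s t) = App (interp \<sigma> s) (interp \<sigma> t)"
| "interp \<sigma> (XLam x t) = Lam (interp (shift \<sigma> x) t)"
| "interp \<sigma> (Fun g ts) = Lam (Var 0)"

fun symbol_free :: "xterm \<Rightarrow> bool" where
  "symbol_free (XVar x) \<longleftrightarrow> True"
| "symbol_free (XApp s t) \<longleftrightarrow> symbol_free s \<and> symbol_free t"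
| "symbol_free (XLam x t) \<longleftrightarrow> symbol_free t"
| "symbol_free (Fun g ts) \<longleftrightarrow> False"

fun fv :: "xterm \<Rightarrow> name set" where
  "fv (XVar x) = {x}"
| "fv (XApp s t) = fv s \<union> fv t"
| "fv (XLam x t) = fv t - {x}"
| "fv (Fun g ts) = (\<Union>t\<in>set ts. fv t)"

lemma interp_cong: "(\<And>x. x \<in> fv t \<Longrightarrow> \<sigma> x = \<tau> x) \<Longrightarrow> interp \<sigma> t = interp \<tau> t"
proof (induction t arbitrary: \<sigma> \<tau>)
  case (XLam x t)
  have "interp (shift \<sigma> x) t = interp (shift \<tau> x) t"
    using XLam.prems by (intro XLam.IH) simp
  then show ?case by simp
next
  case (XApp s t)
  have "interp \<sigma> s = interp \<tau> s" "interp \<sigma> t = interp \<tau> t"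
    using XApp.prems by (auto intro: XApp.IH)
  then show ?case by simp
qed simp_all

lemma interp_lift: "lam_lift k (interp \<sigma> t) = interp (\<lambda>x. lam_lift k (\<sigma> x)) t"
proof (induction t arbitrary: k \<sigma>)
  case (XLam x t)
  have "(\<lambda>y. lam_lift (Suc k) (shift \<sigma> x y)) = shift (\<lambda>y. lam_lift k (\<sigma> y)) x"
    by (auto simp: lift_lift)
  with XLam show ?case by simp
qed auto

lemma interp_subst: "lam_subst k u (interp \<sigma> t) = interp (\<lambda>x. lam_subst k u (\<sigma> x)) t"
proof (induction t arbitrary: k u \<sigma>)
  case (XLam x t)
  have "(\<lambda>y. lam_subst (Suc k) (lam_lift 0 u) (shift \<sigma> x y)) = shift (\<lambda>y. lam_subst k u (\<sigma> y)) x"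
    by (auto simp: lift_subst_lt)
  with XLam show ?case by simp
qed auto

lemma subst_interp_shift: "lam_subst 0 u (interp (shift \<sigma> x) t) = interp (\<sigma>(x := u)) t"
proof -
  have "(\<lambda>y. lam_subst 0 u (shift \<sigma> x y)) = \<sigma>(x := u)" by auto
  then show ?thesis by (simp add: interp_subst)
qed

lemma interp_nameless: "symbol_free t \<Longrightarrow> interp (\<lambda>x. Var (\<rho> x)) t = nameless \<rho> t"
proof (induction t arbitrary: \<rho>)
  case (XLam x t)
  have "shift (\<lambda>x. Var (\<rho> x)) x = (\<lambda>y. Var (if y = x then 0 else Suc (\<rho> y)))"
    by auto
  with XLam show ?case by (simp del: shift.simps)
qed auto

lemma interp_XApps: "interp \<sigma> (XApps t ts) = Apps (interp \<sigma> t) (map (interp \<sigma>) ts)"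
  unfolding XApps_def by (induction ts arbitrary: t) auto

lemma nameless_XApps: "nameless \<rho> (XApps t ts) = Apps (nameless \<rho> t) (map (nameless \<rho>) ts)"
  unfolding XApps_def by (induction ts arbitrary: t) auto

lemma fv_XApps: "fv (XApps t ts) = fv t \<union> (\<Union>u\<in>set ts. fv u)"
  unfolding XApps_def by (induction ts arbitrary: t) auto

lemma symbol_free_XApps: "symbol_free (XApps t ts) \<longleftrightarrow> symbol_free t \<and> (\<forall>u\<in>set ts. symbol_free u)"
  unfolding XApps_def by (induction ts arbitrary: t) auto

lemma extend_XApps: "extend \<phi> (XApps t ts) = XApps (extend \<phi> t) (map (extend \<phi>) ts)"
  unfolding XApps_def by (induction ts arbitrary: t) auto

lemma extend_symbol_free: "symbol_free t \<Longrightarrow> extend \<phi> t = t"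
  by (induction t) auto

lemma fv_XLams: "fv (XLams xs t) = fv t - set xs"
  unfolding XLams_def by (induction xs) auto

lemma symbol_free_XLams: "symbol_free (XLams xs t) \<longleftrightarrow> symbol_free t"
  unfolding XLams_def by (induction xs) auto

lemma fv_tuple: "fv (tuple ts) = (\<Union>u\<in>set ts. fv u) - {Tvar}"
  by (auto simp: tuple_def fv_XApps)

lemma symbol_free_tuple: "symbol_free (tuple ts) \<longleftrightarrow> (\<forall>u\<in>set ts. symbol_free u)"
  by (auto simp: tuple_def symbol_free_XApps)

lemma interp_closed: "fv t = {} \<Longrightarrow> interp \<sigma> t = interp \<tau> t"
  by (rule interp_cong) simp

lemma lift_interp_closed: "fv t = {} \<Longrightarrow> lam_lift k (interp \<sigma> t) = interp \<sigma> t"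
  unfolding interp_lift by (rule interp_closed)

fun binds :: "(name \<Rightarrow> lam) \<Rightarrow> name list \<Rightarrow> lam list \<Rightarrow> name \<Rightarrow> lam" where
  "binds \<sigma> (x # xs) (u # us) = binds (\<sigma>(x := u)) xs us"
| "binds \<sigma> _ _ = \<sigma>"

lemma binds_notin: "x \<notin> set xs \<Longrightarrow> binds \<sigma> xs us x = \<sigma> x"
  by (induction \<sigma> xs us rule: binds.induct) auto

lemma binds_nth:
  "distinct xs \<Longrightarrow> length us = length xs \<Longrightarrow> i < length xs \<Longrightarrow> binds \<sigma> xs us (xs ! i) = us ! i"
proof (induction \<sigma> xs us arbitrary: i rule: binds.induct)
  case (1 \<sigma> x xs u us)
  then show ?case by (cases i) (auto simp: binds_notin fun_upd_def)
qed auto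

lemma map_binds:
  assumes "distinct xs" "length us = length xs"
  shows "map (binds \<sigma> xs us) xs = us"
  using assms by (auto intro!: nth_equalityI simp: binds_nth)

text \<open>The redexes are contracted from the left, each turning its argument into an entry of the
  environment, so it is the \<open>us\<close> that have to lie in \<open>A\<close>.\<close>

lemma head_red_XLams:
  assumes "length us = length xs" and "set us \<subseteq> A"
  shows "head_red A (Apps (interp \<sigma> (XLams xs t)) (us @ ts)) (Apps (interp (binds \<sigma> xs us) t) ts)"
  using assms
proof (induction \<sigma> xs us rule: binds.induct)
  case (1 \<sigma> x xs u us)
  then show ?case
    using head_red.step[of u A "interp (shift \<sigma> x) (XLams xs t)" "us @ ts"]
    by (simp add: XLams_def subst_interp_shift del: shift.simps fun_upd_apply)
qed (auto simp: XLams_def intro: head_red.refl)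

lemma head_red_tuple:
  assumes "u \<in> A" and "Tvar \<notin> (\<Union>t\<in>set ts. fv t)"
  shows "head_red A (Apps (interp \<sigma> (tuple ts)) (u # us)) (Apps u (map (interp \<sigma>) ts @ us))"
proof -
  have "interp (\<sigma>(Tvar := u)) t = interp \<sigma> t" if "t \<in> set ts" for t
    using assms(2) that by (intro interp_cong) auto
  then have eq: "map (interp (\<sigma>(Tvar := u))) ts = map (interp \<sigma>) ts"
    by (rule map_cong[OF HOL.refl])
  have "Apps (interp (\<sigma>(Tvar := u)) (XApps (XVar Tvar) ts)) us = Apps u (map (interp \<sigma>) ts @ us)"
    unfolding interp_XApps eq by simp
  with assms(1) show ?thesis
    using head_red_XLams[of "[u]" "[Tvar]" A \<sigma> "XApps (XVar Tvar) ts" us]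
    by (simp add: tuple_def XLams_def)
qed

text \<open>Passing a binder yields another environment of variables, so the body has to be treated
  for all \<open>\<rho>\<close>.\<close>

lemma sn_interp_XLams:
  assumes "\<And>\<rho>. sn (interp (\<lambda>x. Var (\<rho> x)) t)"
  shows "sn (interp (\<lambda>x. Var (\<rho> x)) (XLams xs t))"
  unfolding XLams_def
proof (induction xs arbitrary: \<rho>)
  case (Cons x xs)
  have "shift (\<lambda>x. Var (\<rho> x)) x = (\<lambda>y. Var (if y = x then 0 else Suc (\<rho> y)))"
    by auto
  with Cons show ?case by (simp add: sn_Lam del: shift.simps)
qed (use assms in simp)


section \<open>Closedness of the representation and the head reduction that fires a rule\<close>

section \<open>The canonical representation\<close>

abbreviation const :: "xterm \<Rightarrow> lam" where
  "const t \<equiv> interp (\<lambda>x. Var (to_nat x)) t"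

text \<open>Leaving the names \<open>V f\<close> to \<open>\<sigma>\<close> lets one body be read in
  two ways: with variables for them, to show that it is strongly normalising, and with the terms
  \<open>T f\<close>, to compute its instances.\<close>

definition inst :: "constr list \<Rightarrow> prog list \<Rightarrow> (name \<Rightarrow> lam) \<Rightarrow> xterm \<Rightarrow> lam" where
  "inst cs fs \<sigma> b = interp \<sigma> (extend (theta cs) (extend (psi fs) b))"

lemma fv_extend: "fv (extend \<phi> t) \<subseteq> fv t \<union> (\<Union>u\<in>ran \<phi>. fv u)"
proof (induction t)
  case (Fun g ts)
  show ?case
  proof (cases "\<phi> g")
    case None
    with Fun show ?thesis by auto
  next
    case (Some u)
    then have "u \<in> ran \<phi>" by (rule ranI)
    then have "fv u \<subseteq> (\<Union>u\<in>ran \<phi>. fv u)" by blast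
    with Some Fun show ?thesis by (auto simp: fv_XApps)
  qed
qed auto

lemma symbol_free_theta_constr: "symbol_free (theta_constr cs c)"
  by (auto simp: theta_constr_def Let_def symbol_free_XLams symbol_free_XApps Pi_sel_def)

text \<open>\<open>psi\<close> removes the programs and \<open>theta\<close> the constructors; the
  tuples inserted by \<open>psi\<close> contain no symbols.\<close>

lemma symbol_free_extend_theta_psi: "symbol_free (extend (theta cs) (extend (psi fs) t))"
proof (induction t)
  case (Fun g ts)
  have "symbol_free psi_tuple" if "psi fs g = Some psi_tuple" for psi_tuple
    using that by (cases g) (auto simp: symbol_free_tuple)
  with Fun show ?case
    by (cases g) (auto simp: extend_XApps symbol_free_XApps extend_symbol_free
        symbol_free_theta_constr)
qed auto

lemma symbol_free_t_prog: "symbol_free (t_prog cs fs f)"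
  by (auto simp: t_prog_def symbol_free_tuple t_rule_def symbol_free_XLams
      symbol_free_extend_theta_psi)

lemma set_xvec: "set (xvec n) = X ` {1..n}"
  by (auto simp: xvec_def)

lemma set_yvec: "set (yvec n) = Y ` {1..n}"
  by (auto simp: yvec_def)

lemma length_xvec [simp]: "length (xvec n) = n"
  by (simp add: xvec_def)

lemma length_yvec [simp]: "length (yvec n) = n"
  by (simp add: yvec_def)

lemma distinct_xvec [simp]: "distinct (xvec n)"
  by (simp add: xvec_def distinct_map inj_on_def)

lemma fv_rule_rhs:
  "fv (rule_rhs f c) \<subseteq> X ` {1..constr_arity c} \<union> Y ` {1..prog_arity f - 1}"
  by (cases f; cases c) auto

locale canonical =
  fixes cs :: "constr list" and fs :: "prog list"
  assumes enum_cs: "enumeration cs" and enum_fs: "enumeration fs"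
begin

text \<open>With two programs, the cyclic list from a given one is the same for both enumerations,
  so the order of \<open>fs\<close> no longer matters.\<close>

lemma cycle_from_fs [simp]:
  "cycle_from fs app = [app, fred]" "cycle_from fs fred = [fred, app]"
proof -
  have "UNIV = {app, fred}" using prog.exhaust by auto
  then have *: "distinct fs" "set fs = {app, fred}"
    using enum_fs by (auto simp: enumeration_def)
  then have "length fs = 2" by (metis distinct_card card_2_iff prog.distinct(1))
  then obtain a b where "fs = [a, b]" by (auto simp: length_Suc_conv numeral_2_eq_2)
  with * have "fs = [app, fred] \<or> fs = [fred, app]" by (auto simp: doubleton_eq_iff)
  then show "cycle_from fs app = [app, fred]" "cycle_from fs fred = [fred, app]"
    by (auto simp: cycle_from_def)
qed

lemma set_cycle_from_fs: "set (cycle_from fs f) = UNIV"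
  by (cases f) (auto intro: prog.exhaust)

text \<open>Zero-based, as \<open>!\<close> demands, whereas \<open>position\<close> counts from
  one.\<close>

definition index :: "constr \<Rightarrow> nat" where
  "index c = length (takeWhile (\<lambda>b. b \<noteq> c) cs)"

lemma index: "index c < length cs" "cs ! index c = c"
proof -
  have "c \<in> set cs" using enum_cs by (simp add: enumeration_def)
  then show "index c < length cs"
    unfolding index_def by (induction cs) auto
  then show "cs ! index c = c"
    unfolding index_def using nth_length_takeWhile by fastforce
qed

abbreviation pi :: "constr \<Rightarrow> xterm" where
  "pi c \<equiv> Pi_sel (length cs) (position cs c)"

lemma position_eq: "position cs c = Suc (index c)"
  by (simp add: position_def index_def)

lemma fv_pi [simp]: "fv (pi c) = {}"
  using index[of c] by (auto simp: Pi_sel_def fv_XLams set_xvec position_eq)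

lemma fv_theta_constr [simp]: "fv (theta_constr cs c) = {}"
  by (auto simp: theta_constr_def Let_def fv_XLams fv_XApps)

text \<open>\<open>theta\<close> inserts closed terms and \<open>psi\<close> only the names
  \<open>V g\<close>, which the abstractions of the rule bind along with its variables.\<close>

lemma fv_t_rule [simp]: "fv (t_rule cs fs f c) = {}"
proof -
  have psi: "(\<Union>u\<in>ran (psi fs). fv u) \<subseteq> range V"
  proof -
    have "fv u \<subseteq> range V" if "psi fs g = Some u" for g u
      using that by (cases g) (auto simp: fv_tuple)
    then show ?thesis by (auto simp: ran_def)
  qed
  have theta: "(\<Union>u\<in>ran (theta cs). fv u) = {}"
  proof -
    have "fv u = {}" if "theta cs g = Some u" for g u
      using that by (cases g) auto
    then show ?thesis by (auto simp: ran_def)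
  qed
  have "fv (extend (theta cs) (extend (psi fs) (rule_rhs f c)))
      \<subseteq> X ` {1..constr_arity c} \<union> Y ` {1..prog_arity f - 1} \<union> range V"
    using fv_extend[of "theta cs" "extend (psi fs) (rule_rhs f c)"]
      fv_extend[of "psi fs" "rule_rhs f c"] fv_rule_rhs[of f c] psi theta
    by blast
  then show ?thesis
    by (auto simp: t_rule_def fv_XLams set_xvec set_yvec set_cycle_from_fs)
qed

lemma fv_t_prog [simp]: "fv (t_prog cs fs f) = {}"
  by (auto simp: t_prog_def fv_tuple)

abbreviation T :: "prog \<Rightarrow> lam" where
  "T f \<equiv> const (t_prog cs fs f)"

definition G :: "symbol \<Rightarrow> lam" where
  "G g = const (the (phi_SF cs fs g))"

lemma phi_SF_Con: "phi_SF cs fs (Con c) = Some (theta_constr cs c)"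
  by (simp add: phi_SF_def map_add_def)

lemma phi_SF_Prog: "phi_SF cs fs (Prog f) = Some (tuple (map (t_prog cs fs) (cycle_from fs f)))"
  by (simp add: phi_SF_def map_add_def)

lemma interp_theta_constr: "interp \<sigma> (theta_constr cs c) = G (Con c)"
  by (simp add: G_def phi_SF_Con interp_closed)

lemma interp_pi: "interp \<sigma> (pi c) = const (pi c)"
  by (simp add: interp_closed)

lemma lift_T [simp]: "lam_lift k (T f) = T f"
  by (simp add: lift_interp_closed)

lemma lift_G [simp]: "lam_lift k (G g) = G g"
  by (cases g) (simp_all add: G_def phi_SF_Con phi_SF_Prog fv_tuple lift_interp_closed)

lemma G_Prog: "G (Prog f) = Lam (Apps (Var 0) (map T (cycle_from fs f)))"
  using interp_closed[OF fv_t_prog]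
  by (cases f) (simp_all add: G_def phi_SF_Prog tuple_def interp_XApps)

lemma inst_XVar [simp]: "inst cs fs \<sigma> (XVar x) = \<sigma> x"
  by (simp add: inst_def)

lemma inst_Con [simp]:
  "inst cs fs \<sigma> (Fun (Con c) ts) = Apps (G (Con c)) (map (inst cs fs \<sigma>) ts)"
  by (simp add: inst_def [abs_def] interp_XApps interp_theta_constr comp_def)

lemma inst_Prog:
  "inst cs fs \<sigma> (Fun (Prog f) ts) =
   Apps (interp \<sigma> (tuple (map (\<lambda>g. XVar (V g)) (cycle_from fs f)))) (map (inst cs fs \<sigma>) ts)"
proof -
  have "extend (theta cs) (tuple (map (\<lambda>g. XVar (V g)) (cycle_from fs f))) =
    tuple (map (\<lambda>g. XVar (V g)) (cycle_from fs f))"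
    by (rule extend_symbol_free) (auto simp: symbol_free_tuple)
  then show ?thesis by (simp add: inst_def [abs_def] extend_XApps interp_XApps comp_def)
qed

text \<open>Substituting the \<open>t\<^sub>f\<close> for the fresh variables \<open>v\<^sub>f\<close> turns \<open>\<psi>\<close> into \<open>\<zeta>\<close>.\<close>

lemma inst_Prog_T:
  assumes "\<And>g. \<sigma> (V g) = T g"
  shows "inst cs fs \<sigma> (Fun (Prog f) ts) = Apps (G (Prog f)) (map (inst cs fs \<sigma>) ts)"
  unfolding inst_Prog G_Prog
  by (simp add: tuple_def interp_XApps comp_def assms)

text \<open>The fixed terms that become arguments of head redexes while a rule fires.\<close>

definition admissible :: "lam set \<Rightarrow> bool" where
  "admissible A \<longleftrightarrow>
   (\<forall>f. T f \<in> A) \<and> (\<forall>c. const (pi c) \<in> A) \<and> (\<forall>f c. const (t_rule cs fs f c) \<in> A)"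

lemma map_interp_XVar: "map (interp \<sigma> \<circ> XVar) xs = map \<sigma> xs"
  by simp

text \<open>A constructor with all its arguments hands control to the next argument
  \<open>t\<close>, passing it the selector of \<open>c\<close>, the arguments and \<open>t\<close>
  itself.\<close>

lemma head_red_Con:
  assumes "length ss = constr_arity c" and "set ss \<subseteq> A" and "t \<in> A"
  shows "head_red A (Apps (G (Con c)) (ss @ t # ts)) (Apps t (const (pi c) # ss @ t # ts))"
proof -
  define n where "n = constr_arity c"
  define \<sigma> where "\<sigma> = binds (\<lambda>x. Var (to_nat x)) (xvec n @ [Fvar]) (ss @ [t])"
  have len: "length ss = length (xvec n)" using assms(1) by (simp add: n_def)
  have Fvar: "Fvar \<notin> set (xvec n)" by (auto simp: set_xvec)
  have "map \<sigma> (xvec n @ [Fvar]) = ss @ [t]"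
    unfolding \<sigma>_def using len Fvar by (intro map_binds) auto
  then have \<sigma>: "map \<sigma> (xvec n) = ss" "\<sigma> Fvar = t" by auto
  have "head_red A (Apps (const (theta_constr cs c)) ((ss @ [t]) @ ts))
     (Apps (interp \<sigma> (XApps (XVar Fvar) (pi c # map XVar (xvec n) @ [XVar Fvar]))) ts)"
    unfolding \<sigma>_def theta_constr_def Let_def n_def
    using assms by (intro head_red_XLams) auto
  moreover have "interp \<sigma> (XApps (XVar Fvar) (pi c # map XVar (xvec n) @ [XVar Fvar])) =
      Apps t (const (pi c) # ss @ [t])"
    unfolding interp_XApps by (simp add: \<sigma> interp_pi [of \<sigma>] map_interp_XVar)
  ultimately show ?thesis by (simp add: interp_theta_constr)
qed

definition rule_env :: "prog \<Rightarrow> constr \<Rightarrow> lam list \<Rightarrow> lam list \<Rightarrow> name \<Rightarrow> lam" where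
  "rule_env f c ss us =
   binds (\<lambda>x. Var (to_nat x))
     (xvec (constr_arity c) @ map V (cycle_from fs f) @ yvec (prog_arity f - 1))
     (ss @ map T (cycle_from fs f) @ us)"

text \<open>Four stages: the constructor calls \<open>T f\<close> with its selector, the tuple
  \<open>T f\<close> offers its components to the selector, the selector picks the rule for
  \<open>c\<close>, and that rule consumes \<open>ss\<close>, the \<open>T g\<close> and
  \<open>us\<close>.\<close>

lemma head_red_rule:
  assumes A: "admissible A"
    and ss: "length ss = constr_arity c" "set ss \<subseteq> A"
    and us: "length us = prog_arity f - 1" "set us \<subseteq> A"
  shows "head_red A (Apps (G (Con c)) (ss @ map T (cycle_from fs f) @ us @ ts))
    (Apps (inst cs fs (rule_env f c ss us) (rule_rhs f c)) ts)"
proof -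
  \<comment> \<open>The cyclic list starts with \<open>T f\<close> itself, which is therefore the
    argument that the constructor calls.\<close>
  obtain gs where gs: "cycle_from fs f = f # gs" by (cases f) auto
  define K where "K = ss @ map T (cycle_from fs f) @ us @ ts"
  define r where "r = length cs"
  \<comment> \<open>The environment of the selector after it has received all components of
    \<open>T f\<close>.\<close>
  let ?\<sigma> = "binds (\<lambda>x. Var (to_nat x)) (xvec r) (map const (map (t_rule cs fs f) cs))"
  have "?\<sigma> (X (position cs c)) = const (t_rule cs fs f c)"
  proof -
    have "xvec r ! index c = X (position cs c)"
      using index(1)[of c] by (simp add: xvec_def position_eq r_def del: upt_Suc)
    then show ?thesis
      using binds_nth[of "xvec r" "map const (map (t_rule cs fs f) cs)" "index c"
          "\<lambda>x. Var (to_nat x)"] index[of c]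
      by (simp add: r_def)
  qed
  then have sel: "interp ?\<sigma> (XVar (X (position cs c))) = const (t_rule cs fs f c)" by simp
  have "head_red A (Apps (G (Con c)) K) (Apps (T f) (const (pi c) # K))"
    unfolding K_def gs using head_red_Con[OF ss, of "T f" "map T gs @ us @ ts"] A
    by (simp add: admissible_def)
  also have "head_red A (Apps (T f) (const (pi c) # K))
      (Apps (const (pi c)) (map const (map (t_rule cs fs f) cs) @ K))"
    unfolding t_prog_def using A by (intro head_red_tuple) (auto simp: admissible_def)
  also have "head_red A (Apps (const (pi c)) (map const (map (t_rule cs fs f) cs) @ K))
      (Apps (const (t_rule cs fs f c)) K)"
    unfolding sel [symmetric] unfolding Pi_sel_def r_def
    using A by (intro head_red_XLams) (auto simp: admissible_def)
  also have "head_red A (Apps (const (t_rule cs fs f c)) K)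
    (Apps (inst cs fs (rule_env f c ss us) (rule_rhs f c)) ts)"
    using head_red_XLams[of "ss @ map T (cycle_from fs f) @ us"
        "xvec (constr_arity c) @ map V (cycle_from fs f) @ yvec (prog_arity f - 1)" A
        "\<lambda>x. Var (to_nat x)" "extend (theta cs) (extend (psi fs) (rule_rhs f c))" ts]
      A ss us
    by (simp add: K_def t_rule_def inst_def rule_env_def admissible_def image_subset_iff)
  finally show ?thesis unfolding K_def .
qed

section \<open>Strong normalisation of the fixed terms of the representation\<close>

lemma sn_head_red_tuple:
  assumes "sn u" and "Tvar \<notin> (\<Union>t\<in>set ts. fv t)" and "sn (Apps u (map (interp \<sigma>) ts @ us))"
  shows "sn (Apps (interp \<sigma> (tuple ts)) (u # us))"
  using head_red_sn[OF head_red_tuple] assms by simp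

lemma sn_pi: "sn (const (pi c))"
  unfolding Pi_sel_def by (rule sn_interp_XLams) (simp add: sn_Var)

text \<open>What remains is an abstraction over a term headed by its bound variable; the arguments
  move under that binder, hence the hypothesis on their lifts.\<close>

lemma sn_Con:
  assumes "length ss = constr_arity c" and "\<And>s. s \<in> set ss \<Longrightarrow> sn s \<and> sn (lam_lift 0 s)"
  shows "sn (Apps (G (Con c)) ss)"
proof -
  define n where "n = constr_arity c"
  define \<sigma> where "\<sigma> = binds (\<lambda>x. Var (to_nat x)) (xvec n) ss"
  define body where "body = XApps (XVar Fvar) (pi c # map XVar (xvec n) @ [XVar Fvar])"
  have \<sigma>: "map \<sigma> (xvec n) = ss"
    unfolding \<sigma>_def using assms(1) by (intro map_binds) (auto simp: n_def)
  have shift: "map (shift \<sigma> Fvar) (xvec n) = map (lam_lift 0) ss"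
    unfolding \<sigma> [symmetric] by (auto simp: set_xvec)
  have "interp (shift \<sigma> Fvar) body =
      Apps (Var 0) (const (pi c) # map (lam_lift 0) ss @ [Var 0])"
    unfolding body_def interp_XApps
    by (simp add: interp_pi [of "shift \<sigma> Fvar"] map_interp_XVar shift del: shift.simps)
      simp
  moreover have "sn (Apps (Var 0) (const (pi c) # map (lam_lift 0) ss @ [Var 0]))"
    by (rule sn_Var_Apps) (auto simp: assms sn_pi sn_Var)
  ultimately have "sn (interp \<sigma> (XLam Fvar body))"
    by (simp add: sn_Lam del: shift.simps)
  moreover have "head_red {s. sn s} (Apps (const (XLams (xvec n) (XLam Fvar body))) (ss @ []))
      (Apps (interp \<sigma> (XLam Fvar body)) [])"
    unfolding \<sigma>_def using assms by (intro head_red_XLams) (auto simp: n_def)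
  moreover have "theta_constr cs c = XLams (xvec n) (XLam Fvar body)"
    by (simp add: theta_constr_def Let_def n_def body_def XLams_def)
  ultimately show ?thesis
    using head_red_sn interp_theta_constr[of "\<lambda>x. Var (to_nat x)" c] by auto
qed

lemma sn_Con_Cons:
  assumes "length ss = constr_arity c" and "\<And>s. s \<in> set ss \<Longrightarrow> sn s" and "sn t"
    and "sn (Apps t (const (pi c) # ss @ t # ts))"
  shows "sn (Apps (G (Con c)) (ss @ t # ts))"
  by (rule head_red_sn[OF head_red_Con]) (use assms in auto)

text \<open>The head of a spine is kept apart from its arguments, so that the rules below compute the
  strong normalisation of the bodies \<open>(b\<^sup>\<psi>)\<^sup>\<theta>\<close> by following their head reduction.\<close>

definition sn_spine :: "lam \<Rightarrow> lam list \<Rightarrow> bool" where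
  "sn_spine s ts \<longleftrightarrow> sn (Apps s ts)"

lemma sn_spine_App [simp]: "sn_spine (App s t) ts \<longleftrightarrow> sn_spine s (t # ts)"
  by (simp add: sn_spine_def)

lemma sn_spine_Var [simp]: "\<forall>t\<in>set ts. sn_spine t [] \<Longrightarrow> sn_spine (Var i) ts"
  by (simp add: sn_spine_def sn_Var_Apps)

lemma sn_spine_pi [simp]: "sn_spine (const (pi c)) []"
  by (simp add: sn_spine_def sn_pi)

lemma sn_spine_psi [simp]:
  assumes "sn_spine u []" and "sn_spine u (map (\<lambda>g. \<sigma> (V g)) (cycle_from fs f) @ us)"
  shows "sn_spine (interp \<sigma> (tuple (map (\<lambda>g. XVar (V g)) (cycle_from fs f)))) (u # us)"
  using sn_head_red_tuple[of u "map (\<lambda>g. XVar (V g)) (cycle_from fs f)" \<sigma> us] assms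
  by (simp add: sn_spine_def comp_def)

lemma sn_spine_Con [simp]:
  assumes "length ss = constr_arity c" and "\<forall>s\<in>set ss. sn_spine s [] \<and> sn_spine (lam_lift 0 s) []"
  shows "sn_spine (G (Con c)) ss"
  using sn_Con assms by (simp add: sn_spine_def)

lemma sn_spine_Con0 [simp]:
  assumes "constr_arity c = 0" and "sn_spine t []" and "sn_spine t (const (pi c) # t # ts)"
  shows "sn_spine (G (Con c)) (t # ts)"
  using sn_Con_Cons[of "[]" c t ts] assms by (simp add: sn_spine_def)

text \<open>In a body the programs are tuples of variables, so no rule can fire: after a few head
  steps each of the twelve bodies shows a variable or a constructor with exactly its
  arguments.\<close>

lemma sn_t_rule: "sn (const (t_rule cs fs f c))"
proof -
  have "sn_spine (inst cs fs (\<lambda>x. Var (\<rho> x)) (rule_rhs f c)) []" for \<rho>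
  proof -
    define P where "P f = interp (\<lambda>x. Var (\<rho> x)) (tuple (map (\<lambda>g. XVar (V g)) (cycle_from fs f)))"
      for f
    have inst: "inst cs fs (\<lambda>x. Var (\<rho> x)) (Fun (Prog f) ts) =
        Apps (P f) (map (inst cs fs (\<lambda>x. Var (\<rho> x))) ts)" for f ts
      unfolding P_def by (rule inst_Prog)
    have [simp]: "sn_spine (P f) (u # us)"
      if "sn_spine u []" "sn_spine u (map (\<lambda>g. Var (\<rho> (V g))) (cycle_from fs f) @ us)" for f u us
      unfolding P_def using that by (rule sn_spine_psi)
    show ?thesis
      by (cases f; cases c) (simp_all add: inst)
  qed
  then show ?thesis
    unfolding t_rule_def by (intro sn_interp_XLams) (simp add: inst_def sn_spine_def)
qed

lemma sn_T: "sn (T f)"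
proof -
  have "T f = Lam (Apps (Var 0) (map (const \<circ> t_rule cs fs f) cs))"
    unfolding t_prog_def tuple_def
    by (auto simp: interp_XApps simp del: shift.simps intro!: arg_cong2[where f = "foldl App"]
        interp_closed) simp
  moreover have "sn \<dots>"
    by (rule sn_Lam, rule sn_Var_Apps) (auto simp: sn_t_rule)
  ultimately show ?thesis by simp
qed

lemma admissible_sn: "admissible {s. sn s}"
  by (simp add: admissible_def sn_T sn_pi sn_t_rule)

end


section \<open>Ground rewrite terms, evaluation frames and the SF-terms they stand for\<close>

section \<open>Reduction of ground terms\<close>

text \<open>Unlike in \<open>xterm\<close>, arities are built in, and there are neither variables
  nor binders.\<close>

datatype gterm =
  GS0 | GF0 | GS1 gterm | GF1 gterm | GS2 gterm gterm | GF2 gterm gterm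
  | GApp gterm gterm | GFred gterm gterm gterm

text \<open>Contexts \<open>f(\<box>, u\<^sub>1, \<dots>, u\<^sub>n)\<close>.\<close>

datatype frame = FApp gterm | FFred gterm gterm

fun plug :: "gterm \<Rightarrow> frame \<Rightarrow> gterm" where
  "plug t (FApp u) = GApp t u"
| "plug t (FFred u v) = GFred t u v"

text \<open>The left-hand side of each rule is cut into the constructor term and the frame around
  it, which are the two things the machine brings together.\<close>

inductive root_step :: "gterm \<Rightarrow> frame \<Rightarrow> gterm \<Rightarrow> bool" where
  "root_step GS0 (FApp z) (GS1 z)"
| "root_step (GS1 x) (FApp z) (GS2 x z)"
| "root_step (GS2 x y) (FApp z) (GApp (GApp x z) (GApp y z))"
| "root_step GF0 (FApp z) (GF1 z)"
| "root_step (GF1 x) (FApp z) (GF2 x z)"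
| "root_step (GF2 x y) (FApp z) (GFred x y z)"
| "root_step GS0 (FFred y z) y"
| "root_step GF0 (FFred y z) y"
| "root_step (GS1 x) (FFred y z) (GApp (GApp z GS0) x)"
| "root_step (GF1 x) (FFred y z) (GApp (GApp z GF0) x)"
| "root_step (GS2 p q) (FFred y z) (GApp (GApp z (GApp GS0 p)) q)"
| "root_step (GF2 p q) (FFred y z) (GApp (GApp z (GApp GF0 p)) q)"

fun constr_args :: "gterm \<Rightarrow> (constr \<times> gterm list) option" where
  "constr_args GS0 = Some (S0, [])"
| "constr_args GF0 = Some (F0, [])"
| "constr_args (GS1 x) = Some (S1, [x])"
| "constr_args (GF1 x) = Some (F1, [x])"
| "constr_args (GS2 x y) = Some (S2, [x, y])"
| "constr_args (GF2 x y) = Some (F2, [x, y])"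
| "constr_args _ = None"

fun frame_prog :: "frame \<Rightarrow> prog" where
  "frame_prog (FApp u) = app"
| "frame_prog (FFred u v) = fred"

fun frame_args :: "frame \<Rightarrow> gterm list" where
  "frame_args (FApp u) = [u]"
| "frame_args (FFred u v) = [u, v]"

lemma constr_args_arity: "constr_args t = Some (c, ss) \<Longrightarrow> length ss = constr_arity c"
  by (cases t) auto

lemma frame_args_arity: "length (frame_args k) = prog_arity (frame_prog k) - 1"
  by (cases k) auto

lemma root_step_exists: "constr_args t = Some (c, ss) \<Longrightarrow> \<exists>t'. root_step t k t'"
  by (cases t; cases k) (auto intro: root_step.intros)

text \<open>Undoes the currying, so that rules which merely collect arguments become
  identities.\<close>

fun flat :: "gterm \<Rightarrow> sf" where
  "flat GS0 = S"
| "flat GF0 = F"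
| "flat (GS1 x) = S \<cdot> flat x"
| "flat (GF1 x) = F \<cdot> flat x"
| "flat (GS2 x y) = S \<cdot> flat x \<cdot> flat y"
| "flat (GF2 x y) = F \<cdot> flat x \<cdot> flat y"
| "flat (GApp x y) = flat x \<cdot> flat y"
| "flat (GFred x y z) = F \<cdot> flat x \<cdot> flat y \<cdot> flat z"

text \<open>The weights make both the administrative rewrite rules, which \<open>flat\<close> identifies, and the
  passage from a subject \<open>f(t, u\<^sub>1, \<dots>, u\<^sub>n)\<close> to the subject \<open>t\<close> in the frame \<open>f(\<box>, u\<^sub>1, \<dots>, u\<^sub>n)\<close>
  decreasing.\<close>

fun weight :: "gterm \<Rightarrow> nat" where
  "weight GS0 = 0"
| "weight GF0 = 0"
| "weight (GS1 x) = weight x"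
| "weight (GF1 x) = weight x"
| "weight (GS2 x y) = weight x + weight y"
| "weight (GF2 x y) = weight x + weight y"
| "weight (GApp x y) = 3 + weight x + weight y"
| "weight (GFred x y z) = 1 + weight x + weight y + weight z"

fun frame_weight :: "frame \<Rightarrow> nat" where
  "frame_weight (FApp u) = 2 + weight u"
| "frame_weight (FFred u v) = weight u + weight v"

text \<open>The five rules that only collect arguments lose weight; the other seven contract an
  SF-redex.\<close>

lemma root_step_flat:
  "root_step t k t' \<Longrightarrow>
   flat (plug t k) \<rightarrow>SF flat t' \<or>
   flat t' = flat (plug t k) \<and> weight t' < weight t + frame_weight k"
  by (induction rule: root_step.induct)
    (auto intro: sf_S sf_F_atom sf_F_compound factorable.intros)

definition plugs :: "gterm \<Rightarrow> frame list \<Rightarrow> gterm" where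
  "plugs t ks = foldl plug t ks"

lemma plugs_simps [simp]: "plugs t [] = t" "plugs t (k # ks) = plugs (plug t k) ks"
  by (simp_all add: plugs_def)

lemma flat_plug_cong: "flat t = flat t' \<Longrightarrow> flat (plug t k) = flat (plug t' k)"
  by (cases k) auto

lemma flat_plugs_cong: "flat t = flat t' \<Longrightarrow> flat (plugs t ks) = flat (plugs t' ks)"
proof (induction ks arbitrary: t t')
  case (Cons k ks)
  show ?case
    unfolding plugs_simps by (intro Cons.IH flat_plug_cong Cons.prems)
qed simp

lemma red_plugs: "flat t \<rightarrow>SF flat t' \<Longrightarrow> flat (plugs t ks) \<rightarrow>SF flat (plugs t' ks)"
proof (induction ks arbitrary: t t')
  case (Cons k ks)
  have "flat (plug t k) \<rightarrow>SF flat (plug t' k)"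
    using Cons.prems by (cases k) (auto intro: sf_appL sf_appR)
  with Cons.IH show ?case by simp
qed simp

section \<open>A well-founded order from SF-reduction and the subterm relation\<close>

inductive below :: "sf \<Rightarrow> sf \<Rightarrow> bool" where
  red: "M \<rightarrow>SF N \<Longrightarrow> below N M"
| left: "below M (M \<cdot> N)"
| right: "below N (M \<cdot> N)"

abbreviation sf_sn :: "sf \<Rightarrow> bool" where
  "sf_sn \<equiv> Wellfounded.accp (\<lambda>N M. M \<rightarrow>SF N)"

lemma sf_sn_below: "below N M \<Longrightarrow> sf_sn M \<Longrightarrow> sf_sn N"
proof -
  assume "below N M"
  have sub: "sf_sn M'" if "sf_sn (M' \<cdot> N')" for M' N'
  proof -
    have "sf_sn M'" if "sf_sn L" "L = M' \<cdot> N'" for L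
      using that
      by (induction arbitrary: M' rule: accp_induct_rule) (auto intro: accpI sf_appL)
    with that show ?thesis by blast
  qed
  have sub': "sf_sn N'" if "sf_sn (M' \<cdot> N')" for M' N'
  proof -
    have "sf_sn N'" if "sf_sn L" "L = M' \<cdot> N'" for L
      using that
      by (induction arbitrary: N' rule: accp_induct_rule) (auto intro: accpI sf_appR)
    with that show ?thesis by blast
  qed
  assume "sf_sn M"
  with \<open>below N M\<close> show ?thesis
    by cases (auto intro: sub sub' accp_downward)
qed

text \<open>A reduction of a subterm is one of the whole term, so the subterm steps in an infinite
  \<open>below\<close>-descent can be postponed.\<close>

lemma accp_below: "sf_sn M \<Longrightarrow> Wellfounded.accp below M"
proof (induction rule: accp_induct_rule)
  case (1 M)
  \<comment> \<open>Structural induction, assuming that all reducts are accessible. A reduct of a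
    component is a component of a reduct of the whole term, hence accessible by downward
    closure.\<close>
  have "Wellfounded.accp below M"
    if "\<And>N. M \<rightarrow>SF N \<Longrightarrow> Wellfounded.accp below N" for M
    using that
  proof (induction M rule: sf.induct)
    case (SF_App M N)
    have sub: "Wellfounded.accp below M"
    proof (rule SF_App.IH(1))
      fix M' assume "M \<rightarrow>SF M'"
      then have "Wellfounded.accp below (M' \<cdot> N)" by (intro SF_App.prems sf_appL)
      then show "Wellfounded.accp below M'" by (rule accp_downward) (rule below.left)
    qed
    have sub': "Wellfounded.accp below N"
    proof (rule SF_App.IH(2))
      fix N' assume "N \<rightarrow>SF N'"
      then have "Wellfounded.accp below (M \<cdot> N')" by (intro SF_App.prems sf_appR)
      then show "Wellfounded.accp below N'" by (rule accp_downward) (rule below.right)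
    qed
    show ?case
    proof (rule accpI)
      fix L assume "below L (M \<cdot> N)"
      then show "Wellfounded.accp below L"
        by cases (use sub sub' SF_App.prems in auto)
    qed
  next
    case S
    show ?case by (rule accpI) (erule below.cases; auto intro: S)
  next
    case F
    show ?case by (rule accpI) (erule below.cases; auto intro: F)
  qed
  with 1 show ?case by blast
qed

text \<open>Restricted to strongly normalising upper elements to be well-founded on all SF-terms;
  transitive, since redex arguments may lie several levels down.\<close>

definition below_rel :: "(sf \<times> sf) set" where
  "below_rel = {(N, M). sf_sn M \<and> below\<^sup>+\<^sup>+ N M}"

lemma wf_below_rel: "wf below_rel"
proof -
  have "wf {(N, M). sf_sn M \<and> below N M}"
  proof (rule wfI_min)
    fix M :: sf and Q assume "M \<in> Q"
    show "\<exists>z\<in>Q. \<forall>y. (y, z) \<in> {(N, M). sf_sn M \<and> below N M} \<longrightarrow> y \<notin> Q"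
    proof (cases "sf_sn M")
      case True
      then have "Wellfounded.accp below M" by (rule accp_below)
      then show ?thesis using \<open>M \<in> Q\<close>
        by (induction rule: accp_induct_rule) blast
    qed (use \<open>M \<in> Q\<close> in blast)
  qed
  then have "wf ({(N, M). sf_sn M \<and> below N M}\<^sup>+)" by (rule wf_trancl)
  moreover have "below_rel \<subseteq> {(N, M). sf_sn M \<and> below N M}\<^sup>+"
  proof (clarsimp simp: below_rel_def)
    fix N M assume "below\<^sup>+\<^sup>+ N M" "sf_sn M"
    then show "(N, M) \<in> {(N, M). sf_sn M \<and> below N M}\<^sup>+"
    proof (induction rule: tranclp_induct)
      case (base M)
      then show ?case by auto
    next
      case (step L M)
      \<comment> \<open>Strong normalisation is inherited downwards, so every term of the chain
        satisfies the restriction.\<close>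
      then have "sf_sn L" using sf_sn_below by blast
      with step have "(N, L) \<in> {(N, M). sf_sn M \<and> below N M}\<^sup>+" by blast
      with step show ?case by (auto intro: trancl_into_trancl)
    qed
  qed
  ultimately show ?thesis by (rule wf_subset)
qed

lemma below_App:
  "below\<^sup>+\<^sup>+ M (M \<cdot> N)" "below\<^sup>+\<^sup>+ N (M \<cdot> N)"
  "below\<^sup>+\<^sup>+ L M \<Longrightarrow> below\<^sup>+\<^sup>+ L (M \<cdot> N)" "below\<^sup>+\<^sup>+ L N \<Longrightarrow> below\<^sup>+\<^sup>+ L (M \<cdot> N)"
  by (auto intro: below.intros tranclp.trancl_into_trancl)

lemma below_plugs: "below\<^sup>+\<^sup>+ N (flat t) \<Longrightarrow> below\<^sup>+\<^sup>+ N (flat (plugs t ks))"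
proof (induction ks arbitrary: t)
  case (Cons k ks)
  have "below\<^sup>+\<^sup>+ N (flat (plug t k))"
    using Cons.prems
    by (cases k) (auto intro: below_App)
  then show ?case using Cons.IH by simp
qed simp

lemma below_frame_args: "u \<in> set (frame_args k) \<Longrightarrow> below\<^sup>+\<^sup>+ (flat u) (flat (plug t k))"
  by (cases k) (auto intro: below_App)

lemma below_subject: "below\<^sup>+\<^sup>+ (flat t) (flat (plug t k))"
  by (cases k) (auto intro: below_App)

lemma below_constr_args:
  "constr_args t = Some (c, ss) \<Longrightarrow> s \<in> set ss \<Longrightarrow> below\<^sup>+\<^sup>+ (flat s) (flat t)"
  by (cases t) (auto, (meson below_App)+)

section \<open>The abstract machine and preservation of strong normalisation\<close>

context canonical
begin

fun val :: "gterm \<Rightarrow> lam" where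
  "val GS0 = G (Con S0)"
| "val GF0 = G (Con F0)"
| "val (GS1 x) = App (G (Con S1)) (val x)"
| "val (GF1 x) = App (G (Con F1)) (val x)"
| "val (GS2 x y) = App (App (G (Con S2)) (val x)) (val y)"
| "val (GF2 x y) = App (App (G (Con F2)) (val x)) (val y)"
| "val (GApp x y) = App (App (G (Prog app)) (val x)) (val y)"
| "val (GFred x y z) = App (App (App (G (Prog fred)) (val x)) (val y)) (val z)"

text \<open>What the subject is applied to once the tuple representing the program has been
  opened.\<close>

definition frame_val :: "frame \<Rightarrow> lam list" where
  "frame_val k = map T (cycle_from fs (frame_prog k)) @ map val (frame_args k)"

lemma lift_val [simp]: "lam_lift k (val t) = val t"
  by (induction t) auto

lemma val_constr: "constr_args t = Some (c, ss) \<Longrightarrow> val t = Apps (G (Con c)) (map val ss)"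
  by (cases t) auto

text \<open>Pushing a frame is the single head step that opens the tuple of its program; the
  argument of that redex is \<open>val t\<close>.\<close>

lemma head_red_plug:
  assumes "val t \<in> A"
  shows "head_red A (Apps (val (plug t k)) ts) (Apps (val t) (frame_val k @ ts))"
proof -
  have "head_red A (Apps (G (Prog f)) (val t # us)) (Apps (val t) (map T (cycle_from fs f) @ us))"
    for f us
    using head_red_tuple[OF assms, of "map (t_prog cs fs) (cycle_from fs f)"
      "\<lambda>x. Var (to_nat x)" us]
    by (simp add: G_def phi_SF_Prog comp_def del: cycle_from_fs)
  from this[of "frame_prog k" "map val (frame_args k) @ ts"] show ?thesis
    by (cases k) (simp_all add: frame_val_def)
qed

text \<open>The environment binds each \<open>V g\<close> to \<open>T g\<close>, so the programs in
  the body become their representations again.\<close>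

lemma inst_rule_env:
  assumes "root_step t k t'" and "constr_args t = Some (c, ss)"
  shows "inst cs fs (rule_env (frame_prog k) c (map val ss) (map val (frame_args k)))
    (rule_rhs (frame_prog k) c) = val t'"
proof -
  define \<sigma> where "\<sigma> = rule_env (frame_prog k) c (map val ss) (map val (frame_args k))"
  have V: "\<sigma> (V g) = T g" for g
    using assms(2) unfolding \<sigma>_def rule_env_def
    by (cases k; cases g; cases t) (auto simp: xvec_def yvec_def numeral_2_eq_2)
  note inst_T = inst_Prog_T[of \<sigma>, OF V]
  show ?thesis
    unfolding \<sigma>_def[symmetric]
    using assms
    by cases (auto simp: inst_T, auto simp: \<sigma>_def rule_env_def xvec_def yvec_def numeral_2_eq_2)
qed

lemma head_red_root_step:
  assumes "admissible A" and "constr_args t = Some (c, ss)"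
    and "\<And>s. s \<in> set ss \<Longrightarrow> val s \<in> A" and "\<And>u. u \<in> set (frame_args k) \<Longrightarrow> val u \<in> A"
    and "root_step t k t'"
  shows "head_red A (Apps (val t) (frame_val k @ ts)) (Apps (val t') ts)"
  using head_red_rule[of A "map val ss" c "map val (frame_args k)" "frame_prog k" ts]
    assms(1-4) inst_rule_env[OF assms(5,2)]
  by (auto simp: frame_val_def val_constr constr_args_arity frame_args_arity)

text \<open>The subject \<open>t\<close> and the frames \<open>ks\<close> are the state of an abstract machine evaluating
  \<open>plugs t ks\<close>, which the head reduction of its representation simulates.\<close>

lemma sn_val:
  assumes "sf_sn (flat (plugs t ks))"
  shows "sn (Apps (val t) (concat (map frame_val ks)))"
  using assms
\<comment> \<open>Lexicographic measure of a state: the represented SF-term first, then the total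
  weight of subject and frames.\<close>
proof (induction "(t, ks)" arbitrary: t ks rule: wf_induct_rule[OF wf_inv_image[OF
        wf_lex_prod[OF wf_below_rel wf_less_than],
        of "\<lambda>(t, ks). (flat (plugs t ks), weight t + sum_list (map frame_weight ks))"]])
  case (1 t ks)
  note sf = "1.prems"
  \<comment> \<open>Redex arguments that come from the state represent SF-terms strictly below the
    current one; each is handled as a state with no frames.\<close>
  have smaller: "sn (val u)" if "below\<^sup>+\<^sup>+ (flat u) (flat (plugs t ks))" for u
  proof -
    have "sf_sn (flat u)"
      using that sf by (induction rule: converse_tranclp_induct) (auto intro: sf_sn_below)
    then have "sn (Apps (val u) (concat (map frame_val [])))"
      using that sf by (intro "1.hyps") (auto simp: below_rel_def)
    then show ?thesis by simp
  qed
  show ?case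
  proof (cases "constr_args t")
    \<comment> \<open>The subject is headed by a program: pushing its frame keeps the SF-term and
      lowers the weight.\<close>
    case None
    then have "\<exists>s k. t = plug s k"
      by (cases t) (auto, metis plug.simps(1), metis plug.simps(2))
    then obtain s k where t: "t = plug s k" by blast
    have s: "sn (val s)"
      by (rule smaller) (auto simp: t intro: below_plugs below_subject)
    have "weight s + frame_weight k < weight (plug s k)" by (cases k) auto
    then have "sn (Apps (val s) (concat (map frame_val (k # ks))))"
      using sf by (intro "1.hyps") (auto simp: t)
    with head_red_sn[OF head_red_plug] s show ?thesis by (simp add: t)
  next
    case (Some p)
    then obtain c ss where c: "constr_args t = Some (c, ss)" by (cases p) auto
    have ss: "sn (val s)" if "s \<in> set ss" for s
      by (rule smaller) (use that c in \<open>auto intro: below_plugs below_constr_args\<close>)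
    show ?thesis
    proof (cases ks)
      \<comment> \<open>A constructor term without frames is a final state.\<close>
      case Nil
      with c ss show ?thesis
        by (auto simp: val_constr constr_args_arity intro!: sn_Con)
    next
      case (Cons k ks')
      obtain t' where t': "root_step t k t'" using root_step_exists[OF c] by blast
      have us: "sn (val u)" if "u \<in> set (frame_args k)" for u
        by (rule smaller) (use that in \<open>auto simp: Cons intro: below_plugs below_frame_args\<close>)
      \<comment> \<open>Firing the rule lowers the first component of the measure if it is an
        SF-step, and otherwise the second.\<close>
      have "sn (Apps (val t') (concat (map frame_val ks')))"
        using root_step_flat[OF t']
      proof
        assume "flat (plug t k) \<rightarrow>SF flat t'"
        then have red: "flat (plugs t ks) \<rightarrow>SF flat (plugs t' ks')"
          by (simp add: Cons red_plugs)
        with sf have "sf_sn (flat (plugs t' ks'))" by (auto intro: accp_downward)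
        then show ?thesis
          using red sf by (intro "1.hyps") (auto simp: below_rel_def intro: below.red)
      next
        assume *: "flat t' = flat (plug t k) \<and> weight t' < weight t + frame_weight k"
        then have "flat (plugs t' ks') = flat (plugs t ks)"
          by (auto simp: Cons intro: flat_plugs_cong)
        then show ?thesis
          using * sf by (intro "1.hyps") (auto simp: Cons)
      qed
      with head_red_sn[OF head_red_root_step[OF admissible_sn c _ _ t']] ss us
      show ?thesis by (simp add: Cons)
    qed
  qed
qed

section \<open>Simulation of SF-reduction by beta-reduction\<close>

lemma betas_root_step:
  assumes "root_step t k t'"
  shows "beta\<^sup>*\<^sup>* (val (plug t k)) (val t')"
proof -
  obtain c ss where c: "constr_args t = Some (c, ss)" using assms by cases auto
  \<comment> \<open>With \<open>UNIV\<close> for \<open>A\<close>, all conditions on redex arguments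
    become trivial.\<close>
  have "head_red UNIV (Apps (val (plug t k)) []) (Apps (val t) (frame_val k @ []))"
    by (rule head_red_plug) simp
  also have "head_red UNIV (Apps (val t) (frame_val k @ [])) (Apps (val t') [])"
    by (rule head_red_root_step[OF _ c _ _ assms]) (auto simp: admissible_def)
  finally show ?thesis using head_red_betas by simp
qed

fun embed :: "sf \<Rightarrow> gterm" where
  "embed S = GS0"
| "embed F = GF0"
| "embed (M \<cdot> N) = GApp (embed M) (embed N)"

lemma flat_embed: "flat (embed M) = M"
  by (induction M) auto

lemma to_lambda_embed: "to_lambda cs fs M = val (embed M)"
proof -
  have "symbol_free (the (phi_SF cs fs g))" for g
    by (cases g) (auto simp: phi_SF_Con phi_SF_Prog symbol_free_theta_constr symbol_free_tuple
        symbol_free_t_prog simp del: cycle_from_fs)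
  then have *: "nameless to_nat u = G g" if "phi_SF cs fs g = Some u" for g u
    unfolding G_def using that interp_nameless [of u to_nat] by (metis option.sel)
  have "nameless to_nat (extend (phi_SF cs fs) (Fun g ts)) =
      Apps (G g) (map (nameless to_nat) (map (extend (phi_SF cs fs)) ts))" for g ts
  proof -
    obtain u where u: "phi_SF cs fs g = Some u"
      by (cases g) (simp_all add: phi_SF_Con phi_SF_Prog)
    then have "nameless to_nat u = G g" by (rule *)
    with u show ?thesis by (simp add: nameless_XApps)
  qed
  then show ?thesis
    unfolding to_lambda_def to_lam_def by (induction M) auto
qed

abbreviation betas_val :: "gterm \<Rightarrow> gterm \<Rightarrow> bool" where
  "betas_val t u \<equiv> beta\<^sup>*\<^sup>* (val t) (val u)"

lemma betas_val_GApp: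
  "betas_val t t' \<Longrightarrow> betas_val u u' \<Longrightarrow> betas_val (GApp t u) (GApp t' u')"
  by (simp add: betas_App)

lemma betas_val_GFred: "betas_val t t' \<Longrightarrow> betas_val (GFred t u v) (GFred t' u v)"
  by (simp add: betas_App)

lemmas betas_val_step = root_step.intros [THEN betas_root_step, unfolded plug.simps]

lemma betas_val_S:
  "betas_val (GApp (GApp (GApp GS0 x) y) z) (GApp (GApp x z) (GApp y z))"
proof -
  have "betas_val (GApp (GApp (GApp GS0 x) y) z) (GApp (GApp (GS1 x) y) z)"
    by (intro betas_val_GApp betas_val_step rtranclp.rtrancl_refl)
  also have "beta\<^sup>*\<^sup>* \<dots> (val (GApp (GS2 x y) z))"
    by (intro betas_val_GApp betas_val_step rtranclp.rtrancl_refl)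
  also have "beta\<^sup>*\<^sup>* \<dots> (val (GApp (GApp x z) (GApp y z)))"
    by (rule betas_val_step)
  finally show ?thesis .
qed

text \<open>A rule for \<open>fred\<close> needs a constructor in its first argument, so
  \<open>w\<close> is evaluated to \<open>w'\<close> there.\<close>

lemma betas_val_F:
  assumes "betas_val w w'"
  shows "betas_val (GApp (GApp (GApp GF0 w) y) z) (GFred w' y z)"
proof -
  have "betas_val (GApp (GApp (GApp GF0 w) y) z) (GApp (GApp (GF1 w) y) z)"
    by (intro betas_val_GApp betas_val_step rtranclp.rtrancl_refl)
  also have "beta\<^sup>*\<^sup>* \<dots> (val (GApp (GF2 w y) z))"
    by (intro betas_val_GApp betas_val_step rtranclp.rtrancl_refl)
  also have "beta\<^sup>*\<^sup>* \<dots> (val (GFred w y z))"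
    by (rule betas_val_step)
  also have "beta\<^sup>*\<^sup>* \<dots> (val (GFred w' y z))"
    by (rule betas_val_GFred[OF assms])
  finally show ?thesis .
qed

text \<open>A compound factorable form is first curried to a constructor term. The rule for
  \<open>fred\<close> then rebuilds its left part with \<open>app\<close>, so that the result is
  literally the embedding of \<open>N \<cdot> P \<cdot> Q\<close>.\<close>

lemma betas_val_red: "M \<rightarrow>SF N \<Longrightarrow> betas_val (embed M) (embed N)"
proof (induction rule: sf_red.induct)
  case (sf_S M N X)
  show ?case by (simp only: embed.simps betas_val_S)
next
  case (sf_F_atom Q M N)
  have "betas_val (embed (F \<cdot> Q \<cdot> M \<cdot> N)) (GFred (embed Q) (embed M) (embed N))"
    unfolding embed.simps by (rule betas_val_F) (rule rtranclp.rtrancl_refl)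
  also have "beta\<^sup>*\<^sup>* \<dots> (val (embed M))"
    using sf_F_atom
    by (elim disjE) (simp_all only: embed.simps betas_val_step)
  finally show ?case .
next
  case (sf_F_compound P Q M N)
  have F: "betas_val (embed (F \<cdot> (P \<cdot> Q) \<cdot> M \<cdot> N)) (GFred t (embed M) (embed N))"
    if "betas_val (embed (P \<cdot> Q)) t" for t
    using betas_val_F[OF that] unfolding embed.simps .
  \<comment> \<open>For an application four factorable forms remain, one for each constructor of
    positive arity.\<close>
  from sf_F_compound show ?case
  proof cases
    case 3
    have "betas_val (embed (F \<cdot> (P \<cdot> Q) \<cdot> M \<cdot> N)) (GFred (GS1 (embed Q)) (embed M) (embed N))"
      unfolding 3 by (rule F[unfolded 3]) (simp only: embed.simps betas_val_step)
    also have "beta\<^sup>*\<^sup>* \<dots> (val (embed (N \<cdot> P \<cdot> Q)))"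
      unfolding 3 embed.simps by (rule betas_val_step)
    finally show ?thesis .
  next
    case 4
    have "betas_val (embed (F \<cdot> (P \<cdot> Q) \<cdot> M \<cdot> N)) (GFred (GF1 (embed Q)) (embed M) (embed N))"
      unfolding 4 by (rule F[unfolded 4]) (simp only: embed.simps betas_val_step)
    also have "beta\<^sup>*\<^sup>* \<dots> (val (embed (N \<cdot> P \<cdot> Q)))"
      unfolding 4 embed.simps by (rule betas_val_step)
    finally show ?thesis .
  next
    case (5 L)
    have "betas_val (embed (P \<cdot> Q)) (GApp (GS1 (embed L)) (embed Q))"
      unfolding 5 embed.simps
      by (intro betas_val_GApp betas_val_step rtranclp.rtrancl_refl)
    also have "beta\<^sup>*\<^sup>* \<dots> (val (GS2 (embed L) (embed Q)))"
      by (rule betas_val_step)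
    finally have "betas_val (embed (F \<cdot> (P \<cdot> Q) \<cdot> M \<cdot> N))
        (GFred (GS2 (embed L) (embed Q)) (embed M) (embed N))"
      by (rule F)
    also have "beta\<^sup>*\<^sup>* \<dots> (val (embed (N \<cdot> P \<cdot> Q)))"
      unfolding 5 embed.simps by (rule betas_val_step)
    finally show ?thesis .
  next
    case (6 L)
    have "betas_val (embed (P \<cdot> Q)) (GApp (GF1 (embed L)) (embed Q))"
      unfolding 6 embed.simps
      by (intro betas_val_GApp betas_val_step rtranclp.rtrancl_refl)
    also have "beta\<^sup>*\<^sup>* \<dots> (val (GF2 (embed L) (embed Q)))"
      by (rule betas_val_step)
    finally have "betas_val (embed (F \<cdot> (P \<cdot> Q) \<cdot> M \<cdot> N))
        (GFred (GF2 (embed L) (embed Q)) (embed M) (embed N))"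
      by (rule F)
    also have "beta\<^sup>*\<^sup>* \<dots> (val (embed (N \<cdot> P \<cdot> Q)))"
      unfolding 6 embed.simps by (rule betas_val_step)
    finally show ?thesis .
  qed
next
  case (sf_appL M M' N)
  show ?case
    unfolding embed.simps by (intro betas_val_GApp sf_appL.IH rtranclp.rtrancl_refl)
next
  case (sf_appR N N' M)
  show ?case
    unfolding embed.simps by (intro betas_val_GApp sf_appR.IH rtranclp.rtrancl_refl)
qed

end

section \<open>Accessibility versus infinite sequences, and the conclusion\<close>

lemma strongly_normalising_iff_accp:
  "strongly_normalising R a \<longleftrightarrow> Wellfounded.accp (\<lambda>y x. R x y) a"
proof
  assume sn: "strongly_normalising R a"
  show "Wellfounded.accp (\<lambda>y x. R x y) a"
  proof (rule ccontr)
    let ?Q = "\<lambda>x. \<not> Wellfounded.accp (\<lambda>y x. R x y) x"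
    assume "?Q a"
    \<comment> \<open>An inaccessible element has an inaccessible successor, so dependent choice
      builds an infinite sequence.\<close>
    then have "\<exists>s. s 0 = a \<and> (\<forall>i. ?Q (s i) \<and> R (s i) (s (Suc i)))"
      using dependent_nat_choice[of "\<lambda>n x. ?Q x \<and> (n = 0 \<longrightarrow> x = a)" "\<lambda>_. R"]
      by (metis not_accp_down nat.distinct(1))
    then show False using sn by (auto simp: strongly_normalising_def)
  qed
next
  assume "Wellfounded.accp (\<lambda>y x. R x y) a"
  then show "strongly_normalising R a"
  proof (induction rule: accp_induct_rule)
    case (1 x)
    show ?case
      unfolding strongly_normalising_def
    proof
      assume "\<exists>s. s 0 = x \<and> (\<forall>i. R (s i) (s (Suc i)))"
      then obtain s where s: "s 0 = x" "\<forall>i. R (s i) (s (Suc i))" by blast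
      \<comment> \<open>The tail of the sequence is an infinite reduction from \<open>s 1\<close>,
        contradicting the induction hypothesis.\<close>
      then have "strongly_normalising R (s 1)" using 1 by (metis One_nat_def)
      then show False
        using s unfolding strongly_normalising_def
        by (auto dest!: spec[of _ "\<lambda>i. s (Suc i)"])
    qed
  qed
qed

theorem mainTheorem5:
  fixes cs :: "constr list" and fs :: "prog list"
  assumes "enumeration cs" and "enumeration fs"
  shows "(\<forall>M N. sf_red\<^sup>*\<^sup>* M N \<longrightarrow> beta\<^sup>*\<^sup>* (to_lambda cs fs M) (to_lambda cs fs N))
       \<and> (\<forall>M. strongly_normalising sf_red M \<longrightarrow> strongly_normalising beta (to_lambda cs fs M))"
proof (intro conjI allI impI)
  interpret canonical cs fs using assms by unfold_locales
  fix M N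
  assume "sf_red\<^sup>*\<^sup>* M N"
  then show "beta\<^sup>*\<^sup>* (to_lambda cs fs M) (to_lambda cs fs N)"
    unfolding to_lambda_embed
    by (induction rule: rtranclp_induct) (auto intro: rtranclp_trans betas_val_red)
next
  interpret canonical cs fs using assms by unfold_locales
  fix M
  assume "strongly_normalising sf_red M"
  then show "strongly_normalising beta (to_lambda cs fs M)"
    \<comment> \<open>The initial state of the machine has no frames and represents
      \<open>M\<close>.\<close>
    using sn_val[of "embed M" "[]"]
    by (simp add: strongly_normalising_iff_accp to_lambda_embed flat_embed)
qed

end
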